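(* Let $D=\{(t,s,x): 0<s<t<\infty,\ |x|<\infty\}$. Let $K(t,s,x)$ be defined, continuous, and differentiable with respect to $x$ in $D$, and suppose there are functions $m$ and $\gamma$ as described in the context (continuous, positive, monotonically increasing, with $\gamma$ differentiable and convex and $\gamma(0)\neq 0$) such that in $D$ $$|K(t,s,x)|\le m(s)\gamma(|x|),\qquad \left|\frac{\partial K}{\partial x}(t,s,x)\right|\le m(s)\gamma'(|x|).$$ Suppose that $\lim_{x\to+\infty}\int_0^x\frac{d\xi}{\gamma(\xi)}=l<\infty$, and let $T_1>0$ be uniquely defined by the equality $\int_0^{T_1}m(s)\,ds=l$. Then the integral equation $$x(t)=\int_0^t K(t,s,x(s))\,ds,\qquad x(0)=0,$$ has a Kantorovich main solution $x(t)$ in $\mathcal C_{[0,T_1)}$. For $t\in[0,T_1)$ the a priori estimate $|x(t)|\le\hat x(t)$ holds, where $\hat x(t)$ is the solution of the Cauchy problem $$\frac{d\hat x}{dt}=m(t)\gamma(\hat x(t)),\qquad \hat x(0)=0,$$ and $\lim_{t\to T_1}\hat x(t)=+\infty$.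
   Context: Functions $m(s)$ and $\gamma(x)$: $m$ is defined, continuous, positive and monotonically increasing for $0<s<\infty$, and is extended to $s=0$ by its limit; $\gamma$ is defined, continuous, positive and monotonically increasing for $0<x<\infty$, extended to $x=0$ by its limit, differentiable on $[0,\infty)$ (one-sided at $0$), and convex, with $\gamma(0)\neq 0$. $\mathcal C_{[0,T_1)}$ denotes the continuous functions on $[0,T_1)$. Kantorovich main solution: a continuous function $x(t)$ satisfying the equation $x(t)=\int_0^tK(t,s,x(s))\,ds$ on an interval is called a Kantorovich main solution on that interval if the sequence $x_n(t)=\int_0^t K(t,s,x_{n-1}(s))\,ds$, $x_0(t)\equiv 0$, converges to $x(t)$ for every $t$ in the interval. *)

theory Defs
  imports "HOL-Analysis.Analysis"
begin

text \<open>
  Functions given on the open half-line and extended to 0 by their limit; values at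
  negative arguments are irrelevant. Monotonicity is understood in the weak sense.
\<close>

definition majorant_fun :: "(real \<Rightarrow> real) \<Rightarrow> bool" where
  "majorant_fun f \<longleftrightarrow>
     continuous_on {0<..} f \<and> (\<forall>s>0. f s > 0) \<and> mono_on {0<..} f \<and>
     (f \<longlongrightarrow> f 0) (at_right 0)"

definition kernel_domain :: "(real \<times> real \<times> real) set" where
  "kernel_domain = {(t, s, x). 0 < s \<and> s < t}"

text \<open>
  The integrals run over the closed interval although a kernel is only meaningful for
  \<open>0 < s < t\<close>: the two endpoints form a null set, so its values there do not matter.
\<close>

primrec kantorovich_iter ::
  "(real \<Rightarrow> real \<Rightarrow> real \<Rightarrow> real) \<Rightarrow> nat \<Rightarrow> real \<Rightarrow> real" where
  "kantorovich_iter K 0 = (\<lambda>t. 0)"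
| "kantorovich_iter K (Suc n) =
     (\<lambda>t. integral {0..t} (\<lambda>s. K t s (kantorovich_iter K n s)))"

text \<open>
  Since \<open>integral\<close> is 0 on non-integrable functions, the existence of all
  integrals involved is demanded explicitly.
\<close>

definition kantorovich_main_solution ::
  "(real \<Rightarrow> real \<Rightarrow> real \<Rightarrow> real) \<Rightarrow> real set \<Rightarrow> (real \<Rightarrow> real) \<Rightarrow> bool" where
  "kantorovich_main_solution K I x \<longleftrightarrow>
     continuous_on I x \<and>
     (\<forall>t\<in>I. ((\<lambda>s. K t s (x s)) has_integral x t) {0..t}) \<and>
     (\<forall>n. \<forall>t\<in>I. (\<lambda>s. K t s (kantorovich_iter K n s)) integrable_on {0..t}) \<and>
     (\<forall>t\<in>I. (\<lambda>n. kantorovich_iter K n t) \<longlonglongrightarrow> x t)"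

text \<open>
  The values of a solution must lie in \<open>[0, \<infinity>)\<close>, the domain of \<open>\<gamma>\<close>;
  the derivative at 0 is one-sided.
\<close>

definition cauchy_solution ::
  "(real \<Rightarrow> real) \<Rightarrow> (real \<Rightarrow> real) \<Rightarrow> real \<Rightarrow> (real \<Rightarrow> real) \<Rightarrow> bool" where
  "cauchy_solution m \<gamma> T y \<longleftrightarrow>
     y 0 = 0 \<and>
     (\<forall>t\<in>{0..<T}. y t \<ge> 0 \<and>
        (y has_real_derivative m t * \<gamma> (y t)) (at t within {0..<T}))"

end

theory Submission
  imports Defs
begin

text \<open>
  With \<open>G\<close> and \<open>M\<close> the antiderivatives of \<open>1 / \<gamma>\<close> and \<open>m\<close> vanishing at 0, separation of
  variables forces \<open>G (xh t) = M t\<close>; since \<open>G\<close> increases to \<open>l = M T\<^sub>1\<close> without reaching it,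
  \<open>xh\<close> exists exactly up to \<open>T\<^sub>1\<close> and blows up there. The bound on \<open>K\<close> shows inductively that
  \<open>xh\<close> dominates all iterates, and dominated convergence gives their continuity. On \<open>[0, T]\<close>
  with \<open>T < T\<^sub>1\<close> the iterates therefore stay in \<open>[-R, R]\<close> for \<open>R = xh T\<close>, where convexity of
  \<open>\<gamma>\<close> makes \<open>K\<close> Lipschitz in its last argument with some constant \<open>L\<close>. So successive iterates
  differ by at most \<open>R (L t)\<^sup>n / n!\<close>, and they converge uniformly on \<open>[0, T]\<close>.
\<close>

section \<open>Majorant functions on the closed half-line\<close>

text \<open>Only \<open>a = 0 < b\<close> takes an argument: \<open>f 0\<close> is a right limit of
  values that are eventually at most \<open>f b\<close>.\<close>

lemma majorant_fun_mono:
  assumes "majorant_fun f" "0 \<le> a" "a \<le> b"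
  shows "f a \<le> f b"
proof -
  have mono: "mono_on {0<..} f" and lim: "(f \<longlongrightarrow> f 0) (at_right 0)"
    using assms(1) by (auto simp: majorant_fun_def)
  consider "a = b" | "a = 0" "0 < b" | "0 < a" using assms by linarith
  then show ?thesis
  proof cases
    case 2
    have "eventually (\<lambda>s. f s \<le> f b) (at_right 0)"
      using eventually_at_right_real[OF \<open>0 < b\<close>]
      by eventually_elim (use mono 2 in \<open>auto simp: mono_on_def\<close>)
    then show ?thesis using tendsto_upperbound[OF lim] 2 by simp
  qed (use mono assms in \<open>auto simp: mono_on_def\<close>)
qed

text \<open>Strict positivity can be lost in the limit at 0, so \<open>m 0 = 0\<close> is possible.
  For \<open>\<gamma>\<close> it is recovered from \<open>\<gamma> 0 \<noteq> 0\<close>.\<close>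

lemma majorant_fun_nonneg:
  assumes "majorant_fun f" "0 \<le> a"
  shows "0 \<le> f a"
proof -
  have "(f \<longlongrightarrow> f 0) (at_right 0)" "\<And>s. s > 0 \<Longrightarrow> f s > 0"
    using assms(1) by (auto simp: majorant_fun_def)
  then have "0 \<le> f 0"
    by (intro tendsto_lowerbound[of f "f 0" "at_right 0"])
       (auto intro!: eventually_at_rightI[of 0 1] less_imp_le)
  then show ?thesis using majorant_fun_mono[OF assms(1) _ assms(2)] by simp
qed

lemma majorant_fun_continuous:
  assumes "majorant_fun f"
  shows "continuous_on {0..} f"
  unfolding continuous_on_eq_continuous_within
proof
  fix s :: real assume "s \<in> {0..}"
  then consider "s = 0" | "s > 0" by force
  then show "continuous (at s within {0..}) f"
  proof cases
    case 1
    then show ?thesis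
      using assms by (simp add: majorant_fun_def continuous_within at_within_Ici_at_right)
  next
    case 2
    then have "isCont f s"
      using assms by (auto simp: majorant_fun_def continuous_on_eq_continuous_at)
    then show ?thesis by (rule continuous_at_imp_continuous_at_within)
  qed
qed

section \<open>The Cauchy problem for the majorant, by separation of variables\<close>

text \<open>Working on the whole line makes the derivatives two-sided everywhere, in particular at
  0, and lets one \<open>F\<close> serve all intervals.\<close>

lemma continuous_real_antiderivative:
  fixes f :: "real \<Rightarrow> real"
  assumes "continuous_on UNIV f"
  obtains F where "F 0 = 0" "\<And>x. (F has_real_derivative f x) (at x)"
    "\<And>a b. a \<le> b \<Longrightarrow> (f has_integral F b - F a) {a..b}"
proof -
  have "\<exists>F. \<forall>x :: real. -\<infinity> < ereal x \<longrightarrow> ereal x < \<infinity> \<longrightarrow> (F has_vector_derivative f x) (at x)"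
    using assms by (intro einterval_antiderivative) (auto simp: continuous_on_eq_continuous_at)
  then obtain F where F: "\<And>x. (F has_vector_derivative f x) (at x)" by auto
  show ?thesis
  proof (rule that[of "\<lambda>x. F x - F 0"])
    show "((\<lambda>x. F x - F 0) has_real_derivative f x) (at x)" for x
      using F[of x] by (auto simp: has_real_derivative_iff_has_vector_derivative
          intro!: derivative_eq_intros)
    show "(f has_integral (F b - F 0) - (F a - F 0)) {a..b}" if "a \<le> b" for a b
      using fundamental_theorem_of_calculus[OF that, of F f] F
      by (simp add: has_vector_derivative_at_within)
  qed simp
qed

theorem majorant_cauchy_problem:
  fixes m \<gamma> :: "real \<Rightarrow> real"
  assumes m: "majorant_fun m"
    and \<gamma>: "majorant_fun \<gamma>"
    and \<gamma>_0: "\<gamma> 0 \<noteq> 0"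
    and l: "((\<lambda>x. integral {0..x} (\<lambda>\<xi>. 1 / \<gamma> \<xi>)) \<longlongrightarrow> l) at_top"
  obtains T xh where
    "T > 0" "(m has_integral l) {0..T}" "\<And>T'. T' > 0 \<Longrightarrow> (m has_integral l) {0..T'} \<Longrightarrow> T' = T"
    "cauchy_solution m \<gamma> T xh"
    "\<And>y t. cauchy_solution m \<gamma> T y \<Longrightarrow> t \<in> {0..<T} \<Longrightarrow> y t = xh t"
    "filterlim xh at_top (at_left T)"
proof -
  have m_pos: "m s > 0" if "s > 0" for s using m that by (simp add: majorant_fun_def)
  have \<gamma>_ge: "\<gamma> 0 \<le> \<gamma> x" if "x \<ge> 0" for x using majorant_fun_mono[OF \<gamma> _ that] by simp
  have \<gamma>0: "\<gamma> 0 > 0" using majorant_fun_nonneg[OF \<gamma>] \<gamma>_0 by (simp add: less_le)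
  have \<gamma>_pos: "\<gamma> (max 0 x) > 0" for x using \<gamma>_ge[of "max 0 x"] \<gamma>0 by linarith
  \<comment> \<open>Precomposing with \<open>max 0\<close> extends \<open>m\<close> and \<open>\<gamma>\<close> continuously to the whole line, so that
    the inverse function theorem also applies at 0.\<close>
  have ext: "continuous_on UNIV (\<lambda>s. f (max 0 s))" if "majorant_fun f" for f :: "real \<Rightarrow> real"
    by (rule continuous_on_compose2[OF majorant_fun_continuous[OF that]])
       (auto intro!: continuous_intros)
  have "continuous_on UNIV (\<lambda>x. 1 / \<gamma> (max 0 x))"
    using \<gamma>_pos by (intro continuous_intros ext \<gamma>) (auto simp: less_imp_neq[symmetric])
  then obtain G where G0: "G 0 = 0"
    and G: "\<And>x. (G has_real_derivative 1 / \<gamma> (max 0 x)) (at x)"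
    and GI: "\<And>a b. a \<le> b \<Longrightarrow> ((\<lambda>x. 1 / \<gamma> (max 0 x)) has_integral G b - G a) {a..b}"
    using continuous_real_antiderivative by blast
  obtain M where M0: "M 0 = 0"
    and M: "\<And>x. (M has_real_derivative m (max 0 x)) (at x)"
    and MI: "\<And>a b. a \<le> b \<Longrightarrow> ((\<lambda>x. m (max 0 x)) has_integral M b - M a) {a..b}"
    using continuous_real_antiderivative[OF ext[OF m]] by blast
  have G_less: "G a < G b" if "a < b" for a b
    using that by (rule DERIV_pos_imp_increasing) (use G \<gamma>_pos in force)
  then have G_mono: "strict_mono G" by (simp add: strict_mono_def)
  have G_cont: "continuous_on S G" for S
    using G DERIV_isCont continuous_at_imp_continuous_on by blast
  have M_cont: "continuous_on S M" for S
    using M DERIV_isCont continuous_at_imp_continuous_on by blast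
  \<comment> \<open>Since \<open>m 0\<close> may vanish, the derivative of \<open>M\<close> is known
    to be positive only in the interior of the interval.\<close>
  have M_less: "M a < M b" if "0 \<le> a" "a < b" for a b
    using \<open>a < b\<close>
    by (rule DERIV_pos_imp_increasing_open)
       (use M m_pos that M_cont in \<open>auto intro!: exI simp: max_def\<close>)
  \<comment> \<open>Beyond 1 the slope of \<open>M\<close> is at least \<open>m 1 > 0\<close>, so
    \<open>M\<close> grows at least linearly and must reach the level \<open>l\<close>.\<close>
  have M_lower: "M t \<ge> M 1 + (t - 1) * m 1" if "t \<ge> 1" for t
  proof -
    have "M 1 - 1 * m 1 \<le> M t - t * m 1"
      using that
    proof (rule DERIV_nonneg_imp_nondecreasing)
      fix x :: real assume "1 \<le> x"
      then have "m 1 \<le> m x" using majorant_fun_mono[OF m, of 1 x] by simp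
      then show "\<exists>y. ((\<lambda>t. M t - t * m 1) has_real_derivative y) (at x) \<and> 0 \<le> y"
        using \<open>1 \<le> x\<close> by (intro exI[of _ "m x - m 1"]) (auto intro!: derivative_eq_intros M)
    qed
    then show ?thesis by (simp add: algebra_simps)
  qed
  have G_int: "integral {0..x} (\<lambda>\<xi>. 1 / \<gamma> \<xi>) = G x" if "x \<ge> 0" for x
  proof -
    have "integral {0..x} (\<lambda>\<xi>. 1 / \<gamma> \<xi>) = integral {0..x} (\<lambda>\<xi>. 1 / \<gamma> (max 0 \<xi>))"
      by (intro integral_cong) auto
    then show ?thesis using GI[OF that] G0 by (simp add: integral_unique)
  qed
  have G_lim: "(G \<longlongrightarrow> l) at_top"
    using l by (rule Lim_transform_eventually)
      (use G_int in \<open>auto intro!: eventually_at_top_linorderI[of 0]\<close>)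
  \<comment> \<open>The limit is never attained: \<open>G x < G (x + 1) \<le> l\<close>. This
    strictness is what produces the blow-up.\<close>
  have G_lt_l: "G x < l" for x
  proof -
    have "G (x + 1) \<le> l"
      by (rule tendsto_lowerbound[OF G_lim])
         (auto intro!: eventually_at_top_linorderI[of "x + 1"] simp: strict_mono_less_eq[OF G_mono])
    then show ?thesis using G_less[of x "x + 1"] by simp
  qed
  have l_pos: "l > 0" using G_lt_l[of 0] G0 by simp
  \<comment> \<open>Chosen so that \<open>(b - 1) * m 1 = l + \<bar>M 1\<bar>\<close>; the linear
    lower bound then gives \<open>M b \<ge> M 1 + l + \<bar>M 1\<bar> \<ge> l\<close>.\<close>
  define b where "b = 1 + (l + \<bar>M 1\<bar>) / m 1"
  have "b \<ge> 1" using l_pos m_pos[of 1] by (simp add: b_def)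
  moreover have "M b \<ge> l"
    using M_lower[OF \<open>b \<ge> 1\<close>] m_pos[of 1] by (simp add: b_def)
  ultimately obtain T where T: "0 \<le> T" "M T = l"
    using IVT'[of M 0 l b] M0 l_pos M_cont by auto
  then have T_pos: "T > 0" using M0 l_pos by (cases "T = 0") auto
  have m_int: "(m has_integral I) {0..t} \<longleftrightarrow> I = M t" if "t \<ge> 0" for I t
  proof -
    have "(m has_integral I) {0..t} \<longleftrightarrow> ((\<lambda>x. m (max 0 x)) has_integral I) {0..t}"
      by (intro has_integral_cong) auto
    then show ?thesis using MI[OF that] M0 has_integral_unique by auto
  qed
  have M_inj: "s = t" if "M s = M t" "0 \<le> s" "0 \<le> t" for s t
    using M_less[of s t] M_less[of t s] that by (cases s t rule: linorder_cases) auto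
  \<comment> \<open>\<open>inv G\<close> is arbitrary off the range of \<open>G\<close>. For
    \<open>t\<close> in \<open>{0..<T}\<close> the value \<open>M t\<close> lies in
    \<open>[0, l)\<close> and is attained by \<open>G\<close> at a nonnegative point, by the
    intermediate value theorem.\<close>
  define xh where "xh = (\<lambda>t. inv G (M t))"
  have inv_G: "inv G (G x) = x" for x
    using G_mono by (simp add: strict_mono_imp_inj_on)
  have G_xh: "G (xh t) = M t \<and> xh t \<ge> 0" if "t \<in> {0..<T}" for t
  proof -
    have "0 \<le> M t" using that M_less[of 0 t] M0 by (cases "t = 0") auto
    moreover have "M t < l" using that M_less[of t T] T by auto
    then have "eventually (\<lambda>x. M t < G x) at_top" by (rule order_tendstoD(1)[OF G_lim])
    then obtain c where "c \<ge> 0" "M t \<le> G c"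
      unfolding eventually_at_top_linorder by (metis less_imp_le linear)
    ultimately obtain x where "x \<ge> 0" "G x = M t"
      using IVT'[of G 0 "M t" c] G_cont G0 by auto
    then show ?thesis using inv_G[of x] by (simp add: xh_def)
  qed
  have xh_deriv: "(xh has_real_derivative m t * \<gamma> (xh t)) (at t within {0..<T})"
    if t: "t \<in> {0..<T}" for t
  proof -
    have "(inv G has_derivative (*) (\<gamma> (xh t))) (at (M t))"
    proof (rule has_derivative_inverse_strong_x[where S = UNIV and f = G])
      show "(G has_derivative (*) (1 / \<gamma> (xh t))) (at (inv G (M t)))"
        using G[of "xh t"] G_xh[OF t] by (simp add: has_field_derivative_def xh_def max_def)
      show "(*) (1 / \<gamma> (xh t)) \<circ> (*) (\<gamma> (xh t)) = id"
        using \<gamma>_pos[of "xh t"] G_xh[OF t] by (auto simp: fun_eq_iff max_def)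
    qed (use G_cont G_xh[OF t] inv_G in \<open>auto simp: xh_def\<close>)
    then have "DERIV (inv G) (M t) :> \<gamma> (xh t)" by (simp add: has_field_derivative_def)
    from DERIV_chain2[OF this M[of t]] show ?thesis
      using t by (auto simp: xh_def max_def mult.commute intro: has_field_derivative_at_within)
  qed
  \<comment> \<open>Along any solution \<open>G (y s) - M s\<close> has derivative 0, hence is
    constant and equal to its value 0 at the start. The condition \<open>y s \<ge> 0\<close> removes
    the \<open>max\<close> in the derivative of \<open>G\<close>.\<close>
  have unique: "y t = xh t" if y: "cauchy_solution m \<gamma> T y" and t: "t \<in> {0..<T}" for y t
  proof -
    have y': "y s \<ge> 0" "(y has_real_derivative m s * \<gamma> (y s)) (at s within {0..<T})"
      if "s \<in> {0..<T}" for s using y that by (auto simp: cauchy_solution_def)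
    have "((\<lambda>s. G (y s) - M s) has_real_derivative 0) (at s within {0..<T})"
      if s: "s \<in> {0..<T}" for s
    proof -
      have "((\<lambda>s. G (y s) - M s) has_real_derivative
          1 / \<gamma> (max 0 (y s)) * (m s * \<gamma> (y s)) - m (max 0 s)) (at s within {0..<T})"
        by (intro derivative_intros DERIV_chain2[OF G] y' has_field_derivative_at_within[OF M] s)
      then show ?thesis using s y'(1)[OF s] \<gamma>_pos[of "y s"] by (simp add: max_def)
    qed
    then obtain c where c: "\<And>s. s \<in> {0..<T} \<Longrightarrow> G (y s) - M s = c"
      using has_field_derivative_zero_constant[of "{0..<T}" "\<lambda>s. G (y s) - M s"] by auto
    have "c = 0" using c[of 0] T_pos y G0 M0 by (simp add: cauchy_solution_def)
    then have "G (y t) = M t" using c[OF t] by simp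
    then show ?thesis using inv_G[of "y t"] by (simp add: xh_def)
  qed
  have blowup: "filterlim xh at_top (at_left T)"
    unfolding filterlim_at_top
  proof
    fix Z
    have "(M \<longlongrightarrow> l) (at_left T)"
      using DERIV_isCont[OF M[of T]] T by (simp add: isCont_def filterlim_at_split)
    \<comment> \<open>Every level \<open>Z\<close> has \<open>G Z < l\<close>, so
      \<open>M t = G (xh t)\<close> overtakes \<open>G Z\<close> before \<open>T\<close>.\<close>
    then have "eventually (\<lambda>t. G Z < M t) (at_left T)"
      by (rule order_tendstoD(1)) (rule G_lt_l)
    then show "eventually (\<lambda>t. Z \<le> xh t) (at_left T)"
      using eventually_at_left_real[OF T_pos]
    proof eventually_elim
      case (elim t)
      then have "G Z < G (xh t)" using G_xh[of t] by auto
      then show ?case using G_mono by (simp add: strict_mono_less)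
    qed
  qed
  show ?thesis
  proof (rule that[of T xh])
    show "(m has_integral l) {0..T}" using m_int T by simp
    show "T' = T" if "T' > 0" "(m has_integral l) {0..T'}" for T'
      using that m_int[of T'] M_inj[of T' T] T by simp
    show "cauchy_solution m \<gamma> T xh"
      using G_xh xh_deriv inv_G[of 0] G0 M0 by (auto simp: cauchy_solution_def xh_def)
  qed (fact T_pos unique blowup)+
qed

section \<open>Integrability and continuity of the Volterra integrals\<close>

lemma kernel_section_continuous:
  fixes K :: "real \<Rightarrow> real \<Rightarrow> real \<Rightarrow> real"
  assumes K: "continuous_on kernel_domain (\<lambda>(t, s, x). K t s x)"
    and u: "continuous_on {0..T} u" and t: "t \<le> T"
  shows "continuous_on {0<..<t} (\<lambda>s. K t s (u s))"
proof -
  have "continuous_on {0<..<t} (\<lambda>s. (t, s, u s))"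
    by (intro continuous_intros continuous_on_subset[OF u]) (use t in auto)
  moreover have "(\<lambda>s. (t, s, u s)) ` {0<..<t} \<subseteq> kernel_domain"
    by (auto simp: kernel_domain_def)
  ultimately show ?thesis using continuous_on_compose2[OF K] by fastforce
qed

text \<open>On the open interval continuity gives measurability and \<open>h\<close> dominates. The
  endpoints, where the kernel is uncontrolled, form a null set.\<close>

lemma volterra_integrable:
  fixes K :: "real \<Rightarrow> real \<Rightarrow> real \<Rightarrow> real"
  assumes "continuous_on kernel_domain (\<lambda>(t, s, x). K t s x)"
    and "continuous_on {0..T} u" and t: "t \<le> T"
    and h: "h integrable_on {0..T}"
    and le: "\<And>s. 0 < s \<Longrightarrow> s < t \<Longrightarrow> \<bar>K t s (u s)\<bar> \<le> h s"
  shows "(\<lambda>s. K t s (u s)) integrable_on {0..t}"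
proof -
  have "h integrable_on {0..t}" by (rule integrable_on_subinterval[OF h]) (use t in auto)
  then show ?thesis
    unfolding integrable_on_Icc_iff_Ioo
    by (rule measurable_bounded_by_integrable_imp_integrable_real[rotated])
       (use le continuous_imp_measurable_on_sets_lebesgue[OF kernel_section_continuous[OF assms(1-3)]]
        in auto)
qed

text \<open>Both the kernel and the range of integration vary with \<open>t\<close>. Extending the
  integrands by zero to a fixed set moves all dependence on \<open>t\<close> into the integrand,
  where dominated convergence with majorant \<open>h\<close> applies along sequences.\<close>

lemma volterra_continuous:
  fixes K :: "real \<Rightarrow> real \<Rightarrow> real \<Rightarrow> real"
  assumes K: "continuous_on kernel_domain (\<lambda>(t, s, x). K t s x)"
    and u: "continuous_on {0..T} u"
    and h: "h integrable_on {0..T}"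
    and le: "\<And>t s. 0 < s \<Longrightarrow> s < t \<Longrightarrow> t \<le> T \<Longrightarrow> \<bar>K t s (u s)\<bar> \<le> h s"
    and h0: "\<And>s. 0 \<le> s \<Longrightarrow> s \<le> T \<Longrightarrow> 0 \<le> h s"
  shows "continuous_on {0..T} (\<lambda>t. integral {0..t} (\<lambda>s. K t s (u s)))"
  unfolding continuous_on_sequentially o_def
proof clarify
  fix tk :: "nat \<Rightarrow> real" and t
  assume t: "t \<in> {0..T}" and tk: "\<forall>k. tk k \<in> {0..T}" and lim: "tk \<longlonglongrightarrow> t"
  define f where "f r s = (if s \<in> {0<..<r} then K r s (u s) else 0)" for r s
  \<comment> \<open>At \<open>s = t\<close> the truncated integrands need not converge.\<close>
  define S where "S = {0..T} - {t}"
  have f_int: "f r integrable_on S" and f_eq: "integral S (f r) = integral {0..r} (\<lambda>s. K r s (u s))"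
    if r: "r \<in> {0..T}" for r
  proof -
    have "(\<lambda>s. K r s (u s)) integrable_on {0..r}"
      by (rule volterra_integrable[OF K u _ h]) (use le r in auto)
    then have "((\<lambda>s. K r s (u s)) has_integral integral {0..r} (\<lambda>s. K r s (u s))) {0<..<r}"
      using integrable_integral has_integral_Icc_iff_Ioo by blast
    then have "(f r has_integral integral {0..r} (\<lambda>s. K r s (u s))) {0..T}"
      unfolding f_def using r by (subst has_integral_restrict) auto
    then have "(f r has_integral integral {0..r} (\<lambda>s. K r s (u s))) S"
      by (subst has_integral_spike_set_eq)
        (auto intro: negligible_subset[of "{t}"] simp: S_def)
    then show "f r integrable_on S" "integral S (f r) = integral {0..r} (\<lambda>s. K r s (u s))"
      by auto
  qed
  have "(\<lambda>k. integral S (f (tk k))) \<longlonglongrightarrow> integral S (f t)"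
  proof (rule dominated_convergence(2)[where h = h])
    show "f (tk k) integrable_on S" for k using f_int tk by blast
    show "h integrable_on S"
      using h by (rule integrable_spike_set) (auto intro: negligible_subset[of "{t}"] simp: S_def)
    show "norm (f (tk k) s) \<le> h s" if "s \<in> S" for k s
      using that tk le[of s "tk k"] h0[of s] by (auto simp: f_def S_def)
    show "(\<lambda>k. f (tk k) s) \<longlonglongrightarrow> f t s" if s: "s \<in> S" for s
    proof -
      consider "s = 0" | "0 < s" "s < t" | "t < s"
        using s by (force simp: S_def)
      then show ?thesis
      proof cases
        case 2
        have ev: "eventually (\<lambda>k. s < tk k) sequentially" using order_tendstoD(1)[OF lim] 2 by simp
        have "((\<lambda>k. (\<lambda>(t, s, x). K t s x) (tk k, s, u s)) \<longlonglongrightarrow> (\<lambda>(t, s, x). K t s x) (t, s, u s))"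
          using ev 2
          by (intro continuous_on_tendsto_compose[OF K])
             (auto intro!: tendsto_intros lim simp: kernel_domain_def elim: eventually_mono)
        then have "(\<lambda>k. K (tk k) s (u s)) \<longlonglongrightarrow> K t s (u s)" by simp
        then have "(\<lambda>k. f (tk k) s) \<longlonglongrightarrow> K t s (u s)"
          by (rule Lim_transform_eventually)
            (use ev 2 in \<open>auto simp: f_def elim: eventually_mono\<close>)
        then show ?thesis using 2 by (simp add: f_def)
      next
        case 3
        have "eventually (\<lambda>k. tk k < s) sequentially" using order_tendstoD(2)[OF lim] 3 by simp
        then have "eventually (\<lambda>k. f (tk k) s = 0) sequentially"
          by eventually_elim (auto simp: f_def)
        then show ?thesis using 3 by (simp add: f_def tendsto_eventually)
      qed (simp add: f_def)
    qed
  qed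
  then show "(\<lambda>k. integral {0..tk k} (\<lambda>s. K (tk k) s (u s))) \<longlonglongrightarrow> integral {0..t} (\<lambda>s. K t s (u s))"
    using f_eq tk t by simp
qed

section \<open>Lipschitz bound for the kernel from convexity\<close>

text \<open>The slopes from \<open>x\<close> to \<open>y\<close> with \<open>x < y < b\<close> are
  at most the slope to \<open>b\<close>; let \<open>y\<close> decrease to \<open>x\<close>. Only the
  limit from the right is taken, which covers the one-sided derivative at \<open>a\<close>.\<close>

lemma convex_deriv_le:
  fixes f :: "real \<Rightarrow> real"
  assumes f: "convex_on {a..} f" and x: "a \<le> x" "x < b"
    and d: "(f has_real_derivative d) (at x within {a..})"
  shows "d \<le> (f b - f x) / (b - x)"
proof -
  have "((\<lambda>y. (f y - f x) / (y - x)) \<longlongrightarrow> d) (at x within {a..})"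
    using d by (simp add: has_field_derivative_iff)
  then have lim: "((\<lambda>y. (f y - f x) / (y - x)) \<longlongrightarrow> d) (at_right x)"
    by (rule filterlim_mono) (use x in \<open>auto intro!: at_le\<close>)
  have "eventually (\<lambda>y. (f y - f x) / (y - x) \<le> (f b - f x) / (b - x)) (at_right x)"
    using eventually_at_right_real[OF x(2)]
  proof eventually_elim
    case (elim y)
    have "(f x - f y) / (x - y) \<le> (f x - f b) / (x - b)"
      by (rule convex_on_slope_le[OF f]) (use x elim in auto)
    then show ?case by (metis minus_diff_eq minus_divide_divide)
  qed
  then show ?thesis using tendsto_upperbound[OF lim] by simp
qed

text \<open>The constant depends only on \<open>T\<close> and \<open>R\<close>:
  \<open>m s \<le> m T\<close> by monotonicity, \<open>\<gamma>'\<close> is controlled by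
  \<open>\<gamma> (R + 1)\<close>, and the mean value inequality on the ball of radius
  \<open>R\<close> concludes.\<close>

lemma kernel_lipschitz:
  assumes m: "majorant_fun m"
    and \<gamma>: "majorant_fun \<gamma>"
    and \<gamma>_deriv: "\<And>x. x \<ge> 0 \<Longrightarrow> (\<gamma> has_real_derivative \<gamma>' x) (at x within {0..})"
    and \<gamma>_convex: "convex_on {0..} \<gamma>"
    and K_deriv: "\<And>t s x. (t, s, x) \<in> kernel_domain \<Longrightarrow>
                    ((\<lambda>y. K t s y) has_real_derivative K\<^sub>x t s x) (at x)"
    and K\<^sub>x_bound: "\<And>t s x. (t, s, x) \<in> kernel_domain \<Longrightarrow> \<bar>K\<^sub>x t s x\<bar> \<le> m s * \<gamma>' \<bar>x\<bar>"
    and st: "0 < s" "s < t" "t \<le> T" and uv: "\<bar>u\<bar> \<le> R" "\<bar>v\<bar> \<le> R"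
  shows "\<bar>K t s u - K t s v\<bar> \<le> m T * \<gamma> (R + 1) * \<bar>u - v\<bar>"
proof -
  have dom: "(t, s, x) \<in> kernel_domain" for x using st by (simp add: kernel_domain_def)
  \<comment> \<open>By convexity \<open>\<gamma>' \<bar>x\<bar>\<close> is at most the slope of the chord from \<open>\<bar>x\<bar>\<close> to
    \<open>R + 1\<close>, whose horizontal extent is at least 1.\<close>
  have bound: "\<bar>K\<^sub>x t s x\<bar> \<le> m T * \<gamma> (R + 1)" if "\<bar>x\<bar> \<le> R" for x
  proof -
    have "\<gamma>' \<bar>x\<bar> \<le> (\<gamma> (R + 1) - \<gamma> \<bar>x\<bar>) / (R + 1 - \<bar>x\<bar>)"
      by (rule convex_deriv_le[OF \<gamma>_convex]) (use that \<gamma>_deriv in auto)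
    also have "\<dots> \<le> (\<gamma> (R + 1) - \<gamma> \<bar>x\<bar>) / 1"
      using that majorant_fun_mono[OF \<gamma>, of "\<bar>x\<bar>" "R + 1"] by (intro divide_left_mono) auto
    also have "\<dots> \<le> \<gamma> (R + 1)" using majorant_fun_nonneg[OF \<gamma>, of "\<bar>x\<bar>"] by simp
    finally have "\<gamma>' \<bar>x\<bar> \<le> \<gamma> (R + 1)" .
    moreover have "0 \<le> \<gamma> (R + 1)" using that by (intro majorant_fun_nonneg[OF \<gamma>]) auto
    moreover have "0 \<le> m s" "m s \<le> m T"
      using majorant_fun_nonneg[OF m] majorant_fun_mono[OF m] st by auto
    ultimately have "m s * \<gamma>' \<bar>x\<bar> \<le> m T * \<gamma> (R + 1)"
      by (meson mult_left_mono mult_right_mono order_trans)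
    then show ?thesis using K\<^sub>x_bound[OF dom, of x] by linarith
  qed
  have "norm (K t s u - K t s v) \<le> m T * \<gamma> (R + 1) * norm (u - v)"
    by (rule field_differentiable_bound[of "cball 0 R" _ "K\<^sub>x t s"])
       (use uv bound in \<open>auto intro: has_field_derivative_at_within[OF K_deriv[OF dom]]\<close>)
  then show ?thesis by simp
qed

section \<open>Uniform convergence of the successive approximations\<close>

lemma picard_iterates_uniform_limit:
  fixes K :: "real \<Rightarrow> real \<Rightarrow> real \<Rightarrow> real"
  defines "X \<equiv> kantorovich_iter K"
  assumes int: "\<And>n t. t \<in> {0..T} \<Longrightarrow> (\<lambda>s. K t s (X n s)) integrable_on {0..t}"
    and bound: "\<And>n t. t \<in> {0..T} \<Longrightarrow> \<bar>X n t\<bar> \<le> R"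
    and lip: "\<And>t s u v. 0 < s \<Longrightarrow> s < t \<Longrightarrow> t \<le> T \<Longrightarrow> \<bar>u\<bar> \<le> R \<Longrightarrow> \<bar>v\<bar> \<le> R \<Longrightarrow>
                \<bar>K t s u - K t s v\<bar> \<le> L * \<bar>u - v\<bar>"
    and L: "0 \<le> L"
  shows "uniform_limit {0..T} X (\<lambda>t. \<Sum>i. X (Suc i) t - X i t) sequentially"
proof -
  \<comment> \<open>Since iterate 0 vanishes, the case \<open>n = 0\<close> is just the bound
    \<open>R\<close> on iterate 1. The induction keeps \<open>t\<close> arbitrary because the
    hypothesis is applied at every \<open>s < t\<close> under the integral.\<close>
  have step: "\<bar>X (Suc n) t - X n t\<bar> \<le> R * ((L * t) ^ n / fact n)" if "t \<in> {0..T}" for n t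
    using that
  proof (induction n arbitrary: t)
    case 0
    then show ?case using bound[of t "Suc 0"] by (simp add: X_def)
  next
    case (Suc n)
    \<comment> \<open>\<open>L\<close> times the bound for step \<open>n\<close>; it is exactly the
      derivative of the bound for step \<open>Suc n\<close>.\<close>
    define g where "g s = L * (R * ((L * s) ^ n / fact n))" for s
    have g: "(g has_integral
        R * ((L * t) ^ Suc n / fact (Suc n)) - R * ((L * 0) ^ Suc n / fact (Suc n))) {0..t}"
    proof (rule fundamental_theorem_of_calculus)
      fix s
      have "((\<lambda>s. R * ((L * s) ^ Suc n / fact (Suc n))) has_real_derivative
          R * (real (Suc n) * (L * s) ^ n * L / fact (Suc n))) (at s within {0..t})"
        by (rule derivative_eq_intros refl | simp del: power_Suc fact_Suc)+
      also have "R * (real (Suc n) * (L * s) ^ n * L / fact (Suc n)) = g s"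
        by (simp add: g_def divide_simps del: of_nat_Suc)
      finally show "((\<lambda>s. R * ((L * s) ^ Suc n / fact (Suc n))) has_vector_derivative g s)
          (at s within {0..t})"
        by (simp add: has_real_derivative_iff_has_vector_derivative)
    qed (use Suc.prems in auto)
    have "X (Suc (Suc n)) t - X (Suc n) t =
        integral {0..t} (\<lambda>s. K t s (X (Suc n) s) - K t s (X n s))"
      using int[OF Suc.prems, of n] int[OF Suc.prems, of "Suc n"]
      by (subst integral_diff) (auto simp: X_def)
    \<comment> \<open>The Lipschitz condition is available only for
      \<open>0 < s < t\<close>.\<close>
    also have "\<dots> = integral {0<..<t} (\<lambda>s. K t s (X (Suc n) s) - K t s (X n s))"
      by (rule integral_open_interval_real)
    also have "norm \<dots> \<le> integral {0<..<t} g"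
    proof (rule integral_norm_bound_integral)
      show "(\<lambda>s. K t s (X (Suc n) s) - K t s (X n s)) integrable_on {0<..<t}"
        using int[OF Suc.prems] by (auto simp flip: integrable_on_Icc_iff_Ioo intro!: integrable_diff)
      show "g integrable_on {0<..<t}" using g by (auto simp flip: integrable_on_Icc_iff_Ioo)
      fix s assume s: "s \<in> {0<..<t}"
      then have "\<bar>K t s (X (Suc n) s) - K t s (X n s)\<bar> \<le> L * \<bar>X (Suc n) s - X n s\<bar>"
        using Suc.prems by (intro lip bound) auto
      also have "\<dots> \<le> g s"
        unfolding g_def using s Suc.prems by (intro mult_left_mono Suc.IH L) auto
      finally show "norm (K t s (X (Suc n) s) - K t s (X n s)) \<le> g s" by simp
    qed
    also have "\<dots> = R * ((L * t) ^ Suc n / fact (Suc n))"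
      using g by (simp flip: integral_open_interval_real add: integral_unique)
    finally show ?case by simp
  qed
  have "uniform_limit {0..T} (\<lambda>n t. \<Sum>i<n. X (Suc i) t - X i t)
      (\<lambda>t. \<Sum>i. X (Suc i) t - X i t) sequentially"
  proof (rule Weierstrass_m_test)
    fix n t assume t: "t \<in> {0..T}"
    have "0 \<le> R" using bound[OF t, of 0] by (simp add: X_def)
    then have "R * ((L * t) ^ n / fact n) \<le> R * ((L * T) ^ n / fact n)"
      using t L by (intro mult_left_mono divide_right_mono power_mono) auto
    then show "norm (X (Suc n) t - X n t) \<le> R * ((L * T) ^ n / fact n)"
      using step[OF t, of n] by simp
  next
    show "summable (\<lambda>n. R * ((L * T) ^ n / fact n))"
      using summable_exp[of "L * T"] by (intro summable_mult) (simp add: divide_inverse mult.commute)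
  qed
  \<comment> \<open>The partial sums telescope to the iterates themselves, again because iterate 0
    is 0.\<close>
  moreover have "(\<Sum>i<n. X (Suc i) t - X i t) = X n t" for n t
    using sum_lessThan_telescope[of "\<lambda>i. X i t" n] by (simp add: X_def)
  ultimately show ?thesis by simp
qed

section \<open>Existence of the main solution and the a priori estimate\<close>

lemma kantorovich_main_solution_exists:
  fixes K :: "real \<Rightarrow> real \<Rightarrow> real \<Rightarrow> real"
  assumes m: "majorant_fun m"
    and \<gamma>: "majorant_fun \<gamma>"
    and \<gamma>_deriv: "\<And>x. x \<ge> 0 \<Longrightarrow> (\<gamma> has_real_derivative \<gamma>' x) (at x within {0..})"
    and \<gamma>_convex: "convex_on {0..} \<gamma>"
    and K_cont: "continuous_on kernel_domain (\<lambda>(t, s, x). K t s x)"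
    and K_deriv: "\<And>t s x. (t, s, x) \<in> kernel_domain \<Longrightarrow>
                    ((\<lambda>y. K t s y) has_real_derivative K\<^sub>x t s x) (at x)"
    and K_bound: "\<And>t s x. (t, s, x) \<in> kernel_domain \<Longrightarrow> \<bar>K t s x\<bar> \<le> m s * \<gamma> \<bar>x\<bar>"
    and K\<^sub>x_bound: "\<And>t s x. (t, s, x) \<in> kernel_domain \<Longrightarrow> \<bar>K\<^sub>x t s x\<bar> \<le> m s * \<gamma>' \<bar>x\<bar>"
    and xh: "cauchy_solution m \<gamma> T\<^sub>1 xh"
  obtains x where "kantorovich_main_solution K {0..<T\<^sub>1} x" "\<And>t. t \<in> {0..<T\<^sub>1} \<Longrightarrow> \<bar>x t\<bar> \<le> xh t"
proof -
  define X where "X = kantorovich_iter K"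
  \<comment> \<open>\<open>h\<close> is the derivative of \<open>xh\<close>, so its integral over
    \<open>{0..t}\<close> is \<open>xh t\<close> again. It thus reproduces the bound
    \<open>xh\<close> from one iterate to the next and also serves as the dominating function
    throughout.\<close>
  define h where "h s = m s * \<gamma> (xh s)" for s
  \<comment> \<open>The series form of the limit does not refer to \<open>T\<close>, so the uniform
    limits on all intervals \<open>{0..T}\<close> are one and the same function.\<close>
  define x where "x t = (\<Sum>i. X (Suc i) t - X i t)" for t
  have xh_nonneg: "0 \<le> xh t" and xh_deriv: "(xh has_real_derivative h t) (at t within {0..<T\<^sub>1})"
    if "t \<in> {0..<T\<^sub>1}" for t
    using xh that by (auto simp: cauchy_solution_def h_def)
  have h_int: "(h has_integral xh t) {0..t}" if t: "t \<in> {0..<T\<^sub>1}" for t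
  proof -
    have "(h has_integral xh t - xh 0) {0..t}"
    proof (rule fundamental_theorem_of_calculus)
      fix s assume s: "s \<in> {0..t}"
      then have "(xh has_real_derivative h s) (at s within {0..t})"
        using t by (intro DERIV_subset[OF xh_deriv]) auto
      then show "(xh has_vector_derivative h s) (at s within {0..t})"
        by (simp add: has_real_derivative_iff_has_vector_derivative)
    qed (use t in auto)
    then show ?thesis using xh by (simp add: cauchy_solution_def)
  qed
  have h_nonneg: "0 \<le> h s" if "s \<in> {0..<T\<^sub>1}" for s
    using that xh_nonneg unfolding h_def
    by (intro mult_nonneg_nonneg majorant_fun_nonneg[OF m] majorant_fun_nonneg[OF \<gamma>]) auto
  have K_le_h: "\<bar>K t s v\<bar> \<le> h s" if "0 < s" "s < t" "t < T\<^sub>1" "\<bar>v\<bar> \<le> xh s" for t s v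
  proof -
    have "\<bar>K t s v\<bar> \<le> m s * \<gamma> \<bar>v\<bar>" using that by (intro K_bound) (simp add: kernel_domain_def)
    also have "\<dots> \<le> h s"
      unfolding h_def using that
      by (intro mult_left_mono majorant_fun_mono[OF \<gamma>] majorant_fun_nonneg[OF m]) auto
    finally show ?thesis .
  qed
  have int: "(\<lambda>s. K t s (u s)) integrable_on {0..t}"
    if u: "continuous_on {0..t} u" "\<And>s. s \<in> {0..t} \<Longrightarrow> \<bar>u s\<bar> \<le> xh s" and t: "t \<in> {0..<T\<^sub>1}" for u t
    by (rule volterra_integrable[OF K_cont u(1) order_refl has_integral_integrable[OF h_int[OF t]]])
       (use K_le_h u t in auto)
  have cont: "continuous_on {0..T} (\<lambda>t. integral {0..t} (\<lambda>s. K t s (u s)))"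
    if u: "continuous_on {0..T} u" "\<And>s. s \<in> {0..T} \<Longrightarrow> \<bar>u s\<bar> \<le> xh s" and T: "T \<in> {0..<T\<^sub>1}" for u T
    by (rule volterra_continuous[OF K_cont u(1) has_integral_integrable[OF h_int[OF T]]])
       (use K_le_h u T h_nonneg in auto)
  \<comment> \<open>Continuity and the bound are proved together: both are required of iterate
    \<open>n\<close> to make the integral defining the next one exist and depend continuously on
    \<open>t\<close>.\<close>
  have X: "continuous_on {0..T} (X n) \<and> (\<forall>t\<in>{0..T}. \<bar>X n t\<bar> \<le> xh t)" if T: "T \<in> {0..<T\<^sub>1}" for n T
  proof (induction n)
    case 0
    then show ?case using xh_nonneg T by (simp add: X_def)
  next
    case (Suc n)
    have "\<bar>X (Suc n) t\<bar> \<le> xh t" if t: "t \<in> {0..T}" for t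
    proof -
      have t1: "t \<in> {0..<T\<^sub>1}" using t T by auto
      have "(\<lambda>s. K t s (X n s)) integrable_on {0..t}"
        by (rule int) (use Suc t T in \<open>auto intro: continuous_on_subset\<close>)
      then have "norm (integral {0<..<t} (\<lambda>s. K t s (X n s))) \<le> integral {0<..<t} h"
        using h_int[OF t1] K_le_h Suc t T
        by (intro integral_norm_bound_integral) (auto simp flip: integrable_on_Icc_iff_Ioo)
      then show ?thesis
        using h_int[OF t1] by (simp add: X_def integral_unique flip: integral_open_interval_real)
    qed
    moreover have "continuous_on {0..T} (X (Suc n))"
      using cont[of T "X n"] Suc T by (simp add: X_def)
    ultimately show ?case by blast
  qed
  have X_int: "(\<lambda>s. K t s (X n s)) integrable_on {0..t}" if "t \<in> {0..<T\<^sub>1}" for n t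
    using X[OF that, of n] by (intro int that) auto
  have unif: "uniform_limit {0..T} X x sequentially" if T: "T \<in> {0..<T\<^sub>1}" for T
  proof -
    have "xh t \<le> xh T" if t: "t \<in> {0..T}" for t
    proof (rule has_integral_subset_le)
      show "(h has_integral xh t) {0..t}" "(h has_integral xh T) {0..T}"
        using h_int t T by auto
    qed (use t T h_nonneg in auto)
    then have "\<bar>X n t\<bar> \<le> xh T" if "t \<in> {0..T}" for n t
      using X[OF T, of n] that by fastforce
    moreover have "(\<lambda>s. K t s (X n s)) integrable_on {0..t}" if "t \<in> {0..T}" for n t
      using X_int T that by auto
    moreover have "0 \<le> m T * \<gamma> (xh T + 1)"
      using T xh_nonneg[of T]
      by (intro mult_nonneg_nonneg majorant_fun_nonneg[OF m] majorant_fun_nonneg[OF \<gamma>]) auto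
    ultimately show ?thesis
      unfolding X_def x_def
      by (intro picard_iterates_uniform_limit[where R = "xh T" and L = "m T * \<gamma> (xh T + 1)"])
         (auto intro: kernel_lipschitz[OF m \<gamma> \<gamma>_deriv \<gamma>_convex K_deriv K\<^sub>x_bound])
  qed
  have lim: "(\<lambda>n. X n t) \<longlonglongrightarrow> x t" if "t \<in> {0..<T\<^sub>1}" for t
    using tendsto_uniform_limitI[OF unif[OF that], of t] that by simp
  have x_cont: "continuous_on {0..T} x" if "T \<in> {0..<T\<^sub>1}" for T
    using X that by (intro uniform_limit_theorem[OF _ unif]) auto
  have x_le: "\<bar>x t\<bar> \<le> xh t" if "t \<in> {0..<T\<^sub>1}" for t
    by (rule tendsto_upperbound[OF tendsto_rabs[OF lim]]) (use X[OF that] that in auto)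
  \<comment> \<open>Pass to the limit in the recursion: the integrals are the next iterates and
    converge to \<open>x t\<close>, while the integrands converge because differentiability makes
    \<open>K t s\<close> continuous in its last argument.\<close>
  have x_eq: "((\<lambda>s. K t s (x s)) has_integral x t) {0..t}" if t: "t \<in> {0..<T\<^sub>1}" for t
    unfolding has_integral_Icc_iff_Ioo
  proof (rule has_integral_dominated_convergence[where h = h])
    show "((\<lambda>s. K t s (X n s)) has_integral X (Suc n) t) {0<..<t}" for n
      using X_int[OF t, of n] by (simp add: X_def has_integral_integral flip: has_integral_Icc_iff_Ioo)
    show "h integrable_on {0<..<t}"
      using h_int[OF t] by (auto simp flip: integrable_on_Icc_iff_Ioo)
    show "\<forall>s\<in>{0<..<t}. norm (K t s (X n s)) \<le> h s" for n
      using K_le_h X[OF t, of n] t by auto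
    show "\<forall>s\<in>{0<..<t}. (\<lambda>n. K t s (X n s)) \<longlonglongrightarrow> K t s (x s)"
    proof
      fix s assume s: "s \<in> {0<..<t}"
      then have "isCont (K t s) (x s)"
        using K_deriv[of t s "x s"] by (intro DERIV_isCont) (simp add: kernel_domain_def)
      then show "(\<lambda>n. K t s (X n s)) \<longlonglongrightarrow> K t s (x s)"
        by (rule isCont_tendsto_compose) (use lim s t in auto)
    qed
    show "(\<lambda>n. X (Suc n) t) \<longlonglongrightarrow> x t" using lim[OF t] by (rule LIMSEQ_Suc)
  qed
  have "continuous_on {0..<T\<^sub>1} x"
    unfolding continuous_on_eq_continuous_within
  proof
    fix t assume t: "t \<in> {0..<T\<^sub>1}"
    \<comment> \<open>Any \<open>T\<close> strictly between \<open>t\<close> and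
      \<open>T\<^sub>1\<close> would do: continuity at \<open>t\<close> is local, and near
      \<open>t\<close> the sets \<open>{0..T}\<close> and \<open>{0..<T\<^sub>1}\<close>
      agree.\<close>
    define T where "T = (t + T\<^sub>1) / 2"
    have T: "T \<in> {0..<T\<^sub>1}" "t < T" using t by (auto simp: T_def)
    have "continuous (at t within {0..T}) x"
      using x_cont[OF T(1)] t T by (auto simp: continuous_on_eq_continuous_within)
    moreover have "at t within {0..<T\<^sub>1} = at t within {0..T}"
      by (rule at_within_nhd[of _ "{..<T}"]) (use T in auto)
    ultimately show "continuous (at t within {0..<T\<^sub>1}) x" by simp
  qed
  then show ?thesis
    using that[of x] x_eq X_int lim x_le by (auto simp: kantorovich_main_solution_def X_def)
qed

theorem theorem2:
  fixes K K\<^sub>x :: "real \<Rightarrow> real \<Rightarrow> real \<Rightarrow> real"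
    and m \<gamma> \<gamma>' :: "real \<Rightarrow> real"
    and l :: real
  assumes m: "majorant_fun m"
    and \<gamma>: "majorant_fun \<gamma>"
    and \<gamma>_deriv: "\<And>x. x \<ge> 0 \<Longrightarrow> (\<gamma> has_real_derivative \<gamma>' x) (at x within {0..})"
    and \<gamma>_convex: "convex_on {0..} \<gamma>"
    and \<gamma>_0: "\<gamma> 0 \<noteq> 0"
    and K_cont: "continuous_on kernel_domain (\<lambda>(t, s, x). K t s x)"
    and K_deriv: "\<And>t s x. (t, s, x) \<in> kernel_domain \<Longrightarrow>
                    ((\<lambda>y. K t s y) has_real_derivative K\<^sub>x t s x) (at x)"
    and K_bound: "\<And>t s x. (t, s, x) \<in> kernel_domain \<Longrightarrow> \<bar>K t s x\<bar> \<le> m s * \<gamma> \<bar>x\<bar>"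
    and K\<^sub>x_bound: "\<And>t s x. (t, s, x) \<in> kernel_domain \<Longrightarrow> \<bar>K\<^sub>x t s x\<bar> \<le> m s * \<gamma>' \<bar>x\<bar>"
    and l: "((\<lambda>x. integral {0..x} (\<lambda>\<xi>. 1 / \<gamma> \<xi>)) \<longlongrightarrow> l) at_top"
  shows "\<exists>T\<^sub>1. T\<^sub>1 > 0 \<and> (m has_integral l) {0..T\<^sub>1} \<and>
           (\<forall>T>0. (m has_integral l) {0..T} \<longrightarrow> T = T\<^sub>1) \<and>
           (\<exists>x xh. kantorovich_main_solution K {0..<T\<^sub>1} x \<and> x 0 = 0 \<and>
                   cauchy_solution m \<gamma> T\<^sub>1 xh \<and>
                   (\<forall>y. cauchy_solution m \<gamma> T\<^sub>1 y \<longrightarrow> (\<forall>t\<in>{0..<T\<^sub>1}. y t = xh t)) \<and>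
                   (\<forall>t\<in>{0..<T\<^sub>1}. \<bar>x t\<bar> \<le> xh t) \<and>
                   filterlim xh at_top (at_left T\<^sub>1))"
proof -
  obtain T\<^sub>1 xh where T\<^sub>1: "T\<^sub>1 > 0" "(m has_integral l) {0..T\<^sub>1}"
      "\<And>T. T > 0 \<Longrightarrow> (m has_integral l) {0..T} \<Longrightarrow> T = T\<^sub>1"
    and xh: "cauchy_solution m \<gamma> T\<^sub>1 xh"
      "\<And>y t. cauchy_solution m \<gamma> T\<^sub>1 y \<Longrightarrow> t \<in> {0..<T\<^sub>1} \<Longrightarrow> y t = xh t"
      "filterlim xh at_top (at_left T\<^sub>1)"
    by (rule majorant_cauchy_problem[OF m \<gamma> \<gamma>_0 l]) blast
  obtain x where x: "kantorovich_main_solution K {0..<T\<^sub>1} x"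
      "\<And>t. t \<in> {0..<T\<^sub>1} \<Longrightarrow> \<bar>x t\<bar> \<le> xh t"
    by (rule kantorovich_main_solution_exists[OF m \<gamma> \<gamma>_deriv \<gamma>_convex K_cont K_deriv K_bound
          K\<^sub>x_bound xh(1)]) blast+
  \<comment> \<open>The a priori estimate at 0, where \<open>xh\<close> vanishes, forces the initial
    value.\<close>
  have "x 0 = 0" using x(2)[of 0] T\<^sub>1(1) xh(1) by (simp add: cauchy_solution_def)
  then show ?thesis using T\<^sub>1 xh x by blast
qed

end
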